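(* The (uncertain) minimum cost $k$-median problem with $n\ge2$ input points and the swap neighborhood admits $(\beta,\gamma)$-improving moves with $\gamma=5/\left(1-\frac1n\right)$ and $\beta=1-\frac{1}{n^2}$; that is, for every feasible $C$ with $\mathrm{Cost}(C)>\gamma\,\mathrm{OPT}$ there is $C'\in\mathcal{N}(C)$ with $\mathrm{Cost}(C')\le\beta\,\mathrm{Cost}(C)$.
   Context: Let $(\mathcal{M},d)$ be a metric space of diameter $1$, $F\subseteq\mathcal{M}$ a finite candidate set of potential cluster centers, and $1\le k\le|F|$. The feasible solutions $\mathcal{X}$ are the $k$-element subsets $C\subseteq F$. The $n$ points have random locations $Z=(Z_1,\dots,Z_n)\sim\mathcal{D}$ with $Z_i\in\mathcal{M}$ taking values in a set $\mathcal{Z}$ of possible locations. With $d(z,C)=\min_{c\in C}d(z,c)$, the expected cost is $\mathrm{Cost}(C)=\mathbb{E}\left[\sum_{i=1}^nd(Z_i,C)\right]=\sum_{i\in[n],z\in\mathcal{Z}}\Pr[Z_i=z]\,d(z,C)$, and $\mathrm{OPT}=\min_{C\in\mathcal{X}}\mathrm{Cost}(C)$. The swap neighborhood is $\mathcal{N}(C)=\{(C\cup\{b\})\setminus\{a\}: a\in C,\ b\in F\setminus C\}$.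
   Formalization: The formal theorem also assumes k ≤ n (no more centers than input points); with only 1 ≤ k ≤ |F| the claim fails for random points, e.g. n = 2, k = 5, both points uniform on five locations each at distance 1/2 from its current center. *)

theory Defs
  imports "HOL-Probability.Probability"
begin

definition set_dist :: "'a::metric_space \<Rightarrow> 'a set \<Rightarrow> real" where
  "set_dist z C = (MIN c\<in>C. dist z c)"

definition feasible :: "'a set \<Rightarrow> nat \<Rightarrow> 'a set set" where
  "feasible F k = {C. C \<subseteq> F \<and> card C = k}"

definition swap_nbhd :: "'a set \<Rightarrow> 'a set \<Rightarrow> 'a set set" where
  "swap_nbhd F C = {(C \<union> {b}) - {a} | a b. a \<in> C \<and> b \<in> F - C}"

text \<open>The random input is a family of random variables on a common probability space \<open>P\<close>;
  its joint law is arbitrary, so the points need be neither independent nor identically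
  distributed.\<close>

definition expected_cost ::
    "'w measure \<Rightarrow> nat \<Rightarrow> (nat \<Rightarrow> 'w \<Rightarrow> 'a::metric_space) \<Rightarrow> 'a set \<Rightarrow> real" where
  "expected_cost P n Z C = (\<integral>\<omega>. (\<Sum>i=1..n. set_dist (Z i \<omega>) C) \<partial>P)"

text \<open>A local search problem given by its feasible solutions \<open>X\<close>, its cost function and its
  neighbourhood structure \<open>N\<close>. The minimum is only meaningful for finite nonempty \<open>X\<close>.\<close>

definition opt_cost :: "'s set \<Rightarrow> ('s \<Rightarrow> real) \<Rightarrow> real" where
  "opt_cost X cost = (MIN C\<in>X. cost C)"

definition improving_moves ::
    "'s set \<Rightarrow> ('s \<Rightarrow> real) \<Rightarrow> ('s \<Rightarrow> 's set) \<Rightarrow> real \<Rightarrow> real \<Rightarrow> bool" where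
  "improving_moves X cost N \<beta> \<gamma> \<longleftrightarrow>
     (\<forall>C\<in>X. cost C > \<gamma> * opt_cost X cost \<longrightarrow> (\<exists>C'\<in>N C. cost C' \<le> \<beta> * cost C))"

text \<open>For locations in a countable set the expected cost is the weighted sum of distances.\<close>

lemma expected_cost_eq_sum:
  fixes Z :: "nat \<Rightarrow> 'w \<Rightarrow> 'a::metric_space"
  assumes "prob_space P" and "bounded (UNIV :: 'a set)"
    and "finite C" and "C \<noteq> {}" and "countable L"
    and Z: "\<And>i. i \<in> {1..n} \<Longrightarrow> Z i \<in> measurable P (count_space L)"
  shows "expected_cost P n Z C =
    (\<Sum>i=1..n. \<Sum>\<^sub>\<infinity>z\<in>L. measure P {\<omega> \<in> space P. Z i \<omega> = z} * set_dist z C)"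
proof -
  interpret prob_space P by fact
  obtain B where B: "\<And>x y :: 'a. dist x y \<le> B"
    using assms(2) by (auto simp: bounded_two_points)
  have bnd: "\<bar>set_dist z C\<bar> \<le> B" for z
  proof -
    have "set_dist z C \<in> dist z ` C"
      unfolding set_dist_def using assms(3,4) by (intro Min_in) auto
    thus ?thesis using B by auto
  qed
  have meas: "(\<lambda>\<omega>. set_dist (Z i \<omega>) C) \<in> borel_measurable P" if "i \<in> {1..n}" for i
    using measurable_compose[OF Z[OF that], of "\<lambda>z. set_dist z C" borel] by simp
  have int: "integrable P (\<lambda>\<omega>. set_dist (Z i \<omega>) C)" if "i \<in> {1..n}" for i
    by (rule integrable_const_bound[of _ B]) (use meas[OF that] bnd in auto)
  have "(\<integral>\<omega>. set_dist (Z i \<omega>) C \<partial>P) =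
      (\<Sum>\<^sub>\<infinity>z\<in>L. measure P {\<omega> \<in> space P. Z i \<omega> = z} * set_dist z C)" if i: "i \<in> {1..n}" for i
  proof -
    let ?D = "distr P (count_space L) (Z i)"
    interpret D: prob_space ?D by (rule prob_space_distr[OF Z[OF i]])
    define w where "w z = measure P {\<omega> \<in> space P. Z i \<omega> = z}" for z
    have em: "emeasure ?D {z} = ennreal (w z)" if "z \<in> L" for z
    proof -
      have "Z i -` {z} \<inter> space P = {\<omega> \<in> space P. Z i \<omega> = z}" by auto
      thus ?thesis using that Z[OF i] by (simp add: emeasure_distr w_def emeasure_eq_measure)
    qed
    have D: "?D = density (count_space L) (\<lambda>z. ennreal (w z))"
    proof (rule measure_eqI_countable[where A = L])
      show "sets (density (count_space L) (\<lambda>z. ennreal (w z))) = Pow L" by simp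
      fix z assume z: "z \<in> L"
      show "emeasure ?D {z} = emeasure (density (count_space L) (\<lambda>z. ennreal (w z))) {z}"
        using z em[OF z] by (simp add: emeasure_density nn_integral_count_space_indicator
            nn_integral_indicator_singleton)
    qed (use \<open>countable L\<close> in auto)
    have w0: "w z \<ge> 0" for z by (simp add: w_def)
    have intD: "integrable ?D (\<lambda>z. set_dist z C)"
      by (rule D.integrable_const_bound[of _ B]) (use bnd in auto)
    hence ic: "integrable (count_space L) (\<lambda>z. w z * set_dist z C)"
      unfolding D by (subst (asm) integrable_density) (auto simp: w0)
    have "(\<integral>\<omega>. set_dist (Z i \<omega>) C \<partial>P) = (\<integral>z. set_dist z C \<partial>?D)"
      by (rule integral_distr[symmetric]) (use Z[OF i] in auto)
    also have "\<dots> = (\<integral>z. w z * set_dist z C \<partial>count_space L)"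
      unfolding D by (subst integral_density) (auto simp: w0)
    also have "\<dots> = infsetsum (\<lambda>z. w z * set_dist z C) L"
      by (simp add: infsetsum_def)
    also have "\<dots> = (\<Sum>\<^sub>\<infinity>z\<in>L. w z * set_dist z C)"
      by (rule infsetsum_infsum) (use ic in \<open>simp add: abs_summable_on_def\<close>)
    finally show ?thesis by (simp add: w_def)
  qed
  thus ?thesis unfolding expected_cost_def by (subst Bochner_Integration.integral_sum) (auto intro: int)
qed

end

theory Submission imports Defs begin

text \<open>Let \<open>C\<close> be a feasible solution, \<open>D\<close> an optimal one, and \<open>\<eta>\<close> a map sending every \<open>f \<in> D\<close> to a
  nearest centre in \<open>C\<close>. Following Arya et al., one pairs every \<open>f \<in> D\<close> with some \<open>\<rho> f \<in> C\<close> that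
  is not the \<open>\<eta>\<close>-image of any other element of \<open>D\<close>, using every centre of \<open>C\<close> at most twice. After
  swapping \<open>\<rho> f\<close> for \<open>f\<close>, a point whose optimal centre is \<open>f\<close> moves to \<open>f\<close>, and any other point that
  lost its centre moves to the \<open>\<eta>\<close>-image of its optimal centre. Already pointwise, before taking
  expectations, the \<open>k\<close> swaps together change the distance by at most \<open>5 d(z, D) - d(z, C)\<close>.
  Hence some swap lowers the cost by at least \<open>(Cost C - 5 OPT) / k\<close>, which exceeds
  \<open>Cost C / (n k) \<ge> Cost C / n\<^sup>2\<close>. As this is a strict decrease, the swap inserts a centre
  outside \<open>C\<close>.\<close>

section \<open>Distance to a finite set of centres\<close>

lemma set_dist_attained:
  assumes "finite C" "C \<noteq> {}"
  obtains c where "c \<in> C" "set_dist z C = dist z c"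
proof -
  have "set_dist z C \<in> dist z ` C"
    unfolding set_dist_def using assms by (intro Min_in) auto
  thus ?thesis using that by auto
qed

lemma set_dist_le: "finite C \<Longrightarrow> c \<in> C \<Longrightarrow> set_dist z C \<le> dist z c"
  unfolding set_dist_def by (intro Min_le) auto

lemma set_dist_nonneg: "finite C \<Longrightarrow> C \<noteq> {} \<Longrightarrow> 0 \<le> set_dist z C"
  by (metis set_dist_attained zero_le_dist)

lemma set_dist_antimono:
  assumes "finite C" "A \<subseteq> C" "A \<noteq> {}"
  shows "set_dist z C \<le> set_dist z A"
  unfolding set_dist_def using assms by (intro Min_antimono) auto

section \<open>Pairing inserted with removed centres\<close>

text \<open>The proof is a count. \<open>S0\<close>, \<open>S1\<close>, \<open>S2\<close> collect
  the centres with no, one, or several preimages, and \<open>D2\<close> the elements mapped into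
  \<open>S2\<close>. Elements outside \<open>D2\<close> keep their own image, which they share with
  nobody; those in \<open>D2\<close> take centres from \<open>S0\<close>, which are nobody's
  image.\<close>

lemma ex_swap_pairing:
  fixes \<eta> :: "'a \<Rightarrow> 'b"
  assumes "finite C" "finite D" "card C = card D" and \<eta>: "\<eta> ` D \<subseteq> C"
  obtains \<rho> where "\<rho> ` D \<subseteq> C" "\<And>f g. f \<in> D \<Longrightarrow> g \<in> D \<Longrightarrow> g \<noteq> f \<Longrightarrow> \<eta> g \<noteq> \<rho> f"
    "\<And>r. card {f\<in>D. \<rho> f = r} \<le> 2"
proof -
  define fib where "fib s = {f\<in>D. \<eta> f = s}" for s
  define S0 where "S0 = {s\<in>C. card (fib s) = 0}"
  define S1 where "S1 = {s\<in>C. card (fib s) = 1}"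
  define S2 where "S2 = {s\<in>C. card (fib s) \<ge> 2}"
  define D2 where "D2 = {f\<in>D. \<eta> f \<in> S2}"
  have fin: "finite S0" "finite S1" "finite S2" "finite D2" "\<And>s. finite (fib s)"
    using assms by (auto simp: S0_def S1_def S2_def D2_def fib_def)
  have cC: "card C = card S0 + card S1 + card S2"
  proof -
    have "C = S0 \<union> S1 \<union> S2" by (auto simp: S0_def S1_def S2_def)
    moreover have "card (S0 \<union> S1 \<union> S2) = card (S0 \<union> S1) + card S2"
      by (rule card_Un_disjoint) (use fin in \<open>auto simp: S0_def S1_def S2_def\<close>)
    moreover have "card (S0 \<union> S1) = card S0 + card S1"
      by (rule card_Un_disjoint) (use fin in \<open>auto simp: S0_def S1_def S2_def\<close>)
    ultimately show ?thesis by simp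
  qed
  have fibsum: "card {f\<in>D. \<eta> f \<in> S} = (\<Sum>s\<in>S. card (fib s))" if "finite S" for S
  proof -
    have "{f\<in>D. \<eta> f \<in> S} = (\<Union>s\<in>S. fib s)" by (auto simp: fib_def)
    thus ?thesis using that fin(5) by (simp add: card_UN_disjoint fib_def disjoint_iff)
  qed
  have D2: "card D2 \<ge> 2 * card S2"
  proof -
    have "2 * card S2 = (\<Sum>s\<in>S2. 2)" by simp
    also have "\<dots> \<le> (\<Sum>s\<in>S2. card (fib s))" by (rule sum_mono) (simp add: S2_def)
    finally show ?thesis using fibsum[OF fin(3)] by (simp add: D2_def)
  qed
  have cD: "card D = card S1 + card D2"
  proof -
    have "D = {f\<in>D. \<eta> f \<in> S1} \<union> D2"
    proof -
      have "card (fib (\<eta> f)) \<noteq> 0" if "f \<in> D" for f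
        using that fin(5) by (auto simp: fib_def)
      moreover have "m = 1 \<or> m \<ge> 2" if "m \<noteq> 0" for m :: nat using that by linarith
      ultimately show ?thesis using \<eta> by (auto simp: D2_def S1_def S2_def)
    qed
    moreover have "card ({f\<in>D. \<eta> f \<in> S1} \<union> D2) = card {f\<in>D. \<eta> f \<in> S1} + card D2"
      by (rule card_Un_disjoint) (use fin assms in \<open>auto simp: D2_def S1_def S2_def\<close>)
    moreover have "card {f\<in>D. \<eta> f \<in> S1} = card S1"
      using fibsum[OF fin(2)] by (simp add: S1_def)
    ultimately show ?thesis by simp
  qed
  \<comment> \<open>Equating \<open>card C\<close> and \<open>card D\<close> gives
    \<open>card D2 = card S0 + card S2\<close>. As \<open>card S2\<close> is at most half of
    \<open>card D2\<close>, \<open>card S0\<close> is at least half of it. The factor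
    \<open>bool\<close> gives each centre in \<open>S0\<close> two slots, which \<open>h\<close>
    fills injectively.\<close>
  have "card D2 \<le> card (S0 \<times> (UNIV :: bool set))"
    using cC cD D2 assms(3) by (simp add: card_cartesian_product)
  then obtain h where h: "h ` D2 \<subseteq> S0 \<times> (UNIV :: bool set)" "inj_on h D2"
    using card_le_inj[of D2 "S0 \<times> (UNIV :: bool set)"] fin by auto
  define \<rho> where "\<rho> f = (if f \<in> D2 then fst (h f) else \<eta> f)" for f
  have S0: "\<rho> f \<in> S0" if "f \<in> D2" for f
    using that h(1) by (force simp: \<rho>_def)
  have S1: "\<rho> f = \<eta> f" "\<eta> f \<in> S1" if "f \<in> D" "f \<notin> D2" for f
  proof -
    show "\<rho> f = \<eta> f" using that by (simp add: \<rho>_def)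
    have "card (fib (\<eta> f)) \<noteq> 0" using that fin(5) by (auto simp: fib_def)
    moreover have "\<not> card (fib (\<eta> f)) \<ge> 2" using that \<eta> by (auto simp: D2_def S2_def)
    ultimately show "\<eta> f \<in> S1" using that \<eta> by (auto simp: S1_def)
  qed
  have single: "f = g" if "f \<in> D" "g \<in> D" "\<eta> f = \<eta> g" "\<eta> f \<in> S1" for f g
  proof -
    have "card (fib (\<eta> f)) = 1" using that by (simp add: S1_def)
    then obtain x where "fib (\<eta> f) = {x}" by (auto simp: card_1_singleton_iff)
    moreover have "f \<in> fib (\<eta> f)" "g \<in> fib (\<eta> f)" using that by (auto simp: fib_def)
    ultimately show ?thesis by auto
  qed
  have disj: "S0 \<inter> S1 = {}" by (auto simp: S0_def S1_def)
  show ?thesis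
  proof
    show "\<rho> ` D \<subseteq> C" using S0 S1 \<eta> by (fastforce simp: S0_def)
    show "\<eta> g \<noteq> \<rho> f" if fg: "f \<in> D" "g \<in> D" "g \<noteq> f" for f g
    proof
      assume eq: "\<eta> g = \<rho> f"
      show False
      proof (cases "f \<in> D2")
        case True
        hence "fib (\<eta> g) = {}" using S0[OF True] eq fin(5) by (simp add: S0_def)
        thus False using fg by (auto simp: fib_def)
      next
        case False
        thus False using S1[OF fg(1)] single[of f g] fg eq by auto
      qed
    qed
    show "card {f\<in>D. \<rho> f = r} \<le> 2" for r
    \<comment> \<open>A centre in \<open>S0\<close> is used only by \<open>D2\<close>, at most once
      per slot. Any other centre is used only by elements outside \<open>D2\<close>, hence lies in
      \<open>S1\<close> and \<open>single\<close> applies.\<close>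
    proof (cases "r \<in> S0")
      case True
      hence sub: "{f\<in>D. \<rho> f = r} \<subseteq> D2" using S1 disj by force
      have "card {f\<in>D. \<rho> f = r} \<le> card ({r} \<times> (UNIV :: bool set))"
      proof (rule card_inj_on_le)
        show "inj_on h {f\<in>D. \<rho> f = r}" using h(2) sub by (rule inj_on_subset)
        show "h ` {f\<in>D. \<rho> f = r} \<subseteq> {r} \<times> UNIV"
        proof (rule image_subsetI)
          fix f assume f: "f \<in> {f\<in>D. \<rho> f = r}"
          hence "f \<in> D2" using sub by blast
          thus "h f \<in> {r} \<times> UNIV" using f by (cases "h f") (auto simp: \<rho>_def)
        qed
      qed simp
      thus ?thesis by (simp add: card_cartesian_product)
    next
      case False
      have "f = g" if "f \<in> D" "g \<in> D" "\<rho> f = r" "\<rho> g = r" for f g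
        using that S0 S1 single False by metis
      hence "card {f\<in>D. \<rho> f = r} \<le> Suc 0"
        using assms(2) by (subst card_le_Suc0_iff_eq) auto
      thus ?thesis by simp
    qed
  qed
qed

section \<open>Effect of all swaps on a single point\<close>

text \<open>Let \<open>c\<close> and \<open>d\<close> be the centres of \<open>z\<close> in
  \<open>C\<close> and \<open>D\<close>. The swap inserting \<open>d\<close> accounts for
  \<open>dist z d - dist z c\<close>. Each swap removing \<open>c\<close> is charged
  \<open>2 * dist z d\<close>, and there are at most two of them, whence the factor 1 + 2 * 2 =
  5.\<close>

lemma sum_swaps_set_dist_le:
  fixes C D :: "'a::metric_space set"
  assumes C: "finite C" "C \<noteq> {}" and D: "finite D" "D \<noteq> {}"
    and \<eta>: "\<And>f. f \<in> D \<Longrightarrow> \<eta> f \<in> C \<and> set_dist f C = dist f (\<eta> f)"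
    and \<rho>: "\<And>f g. f \<in> D \<Longrightarrow> g \<in> D \<Longrightarrow> g \<noteq> f \<Longrightarrow> \<eta> g \<noteq> \<rho> f"
    and two: "\<And>r. card {f\<in>D. \<rho> f = r} \<le> 2"
  shows "(\<Sum>f\<in>D. set_dist z (insert f (C - {\<rho> f})) - set_dist z C)
    \<le> 5 * set_dist z D - set_dist z C"
proof -
  obtain c where c: "c \<in> C" "set_dist z C = dist z c"
    using set_dist_attained[OF C] by blast
  obtain d where d: "d \<in> D" "set_dist z D = dist z d"
    using set_dist_attained[OF D] by blast
  have "set_dist z (insert f (C - {\<rho> f})) - dist z c
      \<le> (if f = d then dist z d - dist z c else 0) + (if \<rho> f = c then 2 * dist z d else 0)"
    if f: "f \<in> D" for f
  proof -
    have le: "set_dist z (insert f (C - {\<rho> f})) \<le> dist z x" if "x \<in> insert f (C - {\<rho> f})" for x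
      using that C by (intro set_dist_le) auto
    consider "f = d" | "f \<noteq> d" "\<rho> f = c" | "f \<noteq> d" "\<rho> f \<noteq> c" by blast
    thus ?thesis
    proof cases
      case 1
      \<comment> \<open>The point moves to \<open>d\<close> even if this swap also removes
        \<open>c\<close>; the second charge is then merely a nonnegative surplus.\<close>
      thus ?thesis using le[of f] zero_le_dist[of z d] by (auto simp del: zero_le_dist)
    next
      case 2
      \<comment> \<open>The centre \<open>\<eta> d\<close> survives the swap because
        \<open>d \<noteq> f\<close>. Being nearest to \<open>d\<close>, it is at distance at most
        \<open>dist z d + dist d c\<close> from \<open>z\<close>, hence at most
        \<open>2 * dist z d + dist z c\<close>.\<close>
      have "dist d (\<eta> d) \<le> dist d c"
        using \<eta>[OF d(1)] set_dist_le[OF C(1) c(1), of d] by simp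
      moreover have "dist z (\<eta> d) \<le> dist z d + dist d (\<eta> d)" by (rule dist_triangle)
      moreover have "dist d c \<le> dist z d + dist z c" by (rule dist_triangle3)
      moreover have "set_dist z (insert f (C - {\<rho> f})) \<le> dist z (\<eta> d)"
        using le \<eta>[OF d(1)] \<rho>[OF f d(1)] 2 by auto
      ultimately show ?thesis using 2 by simp
    next
      case 3
      thus ?thesis using le[of c] c by simp
    qed
  qed
  hence "(\<Sum>f\<in>D. set_dist z (insert f (C - {\<rho> f})) - set_dist z C)
      \<le> (\<Sum>f\<in>D. (if f = d then dist z d - dist z c else 0) + (if \<rho> f = c then 2 * dist z d else 0))"
    unfolding c(2) by (rule sum_mono)
  also have "\<dots> = dist z d - dist z c + card {f\<in>D. \<rho> f = c} * (2 * dist z d)"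
    using D d by (simp add: sum.distrib sum.If_cases Int_def)
  also have "\<dots> \<le> dist z d - dist z c + 2 * (2 * dist z d)"
    using two[of c] by (intro add_left_mono mult_right_mono) auto
  finally show ?thesis using c d by simp
qed

section \<open>Integrability and monotonicity of the expected cost\<close>

text \<open>Every real function on \<open>count_space L\<close> is measurable, and bounded distances
  are integrable on a probability space. This licenses linearity and monotonicity of the integral
  below.\<close>

lemma integrable_sum_set_dist:
  fixes Z :: "nat \<Rightarrow> 'w \<Rightarrow> 'a::metric_space"
  assumes "prob_space P" and "bounded (UNIV :: 'a set)" and "finite C" and "C \<noteq> {}"
    and Z: "\<And>i. i \<in> {1..n} \<Longrightarrow> Z i \<in> measurable P (count_space L)"
  shows "integrable P (\<lambda>\<omega>. \<Sum>i=1..n. set_dist (Z i \<omega>) C)"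
proof -
  interpret prob_space P by fact
  obtain B where B: "\<And>x y :: 'a. dist x y \<le> B"
    using assms(2) by (auto simp: bounded_two_points)
  have bnd: "\<bar>set_dist z C\<bar> \<le> B" for z
    using set_dist_attained[OF assms(3,4)] B by (metis abs_of_nonneg zero_le_dist)
  have "integrable P (\<lambda>\<omega>. set_dist (Z i \<omega>) C)" if "i \<in> {1..n}" for i
  proof (rule integrable_const_bound[of _ B])
    show "(\<lambda>\<omega>. set_dist (Z i \<omega>) C) \<in> borel_measurable P"
      using measurable_compose[OF Z[OF that], of "\<lambda>z. set_dist z C" borel] by simp
  qed (use bnd in auto)
  thus ?thesis by (intro Bochner_Integration.integrable_sum)
qed

lemma expected_cost_antimono:
  fixes Z :: "nat \<Rightarrow> 'w \<Rightarrow> 'a::metric_space"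
  assumes "prob_space P" and "bounded (UNIV :: 'a set)" and "finite C" and "A \<subseteq> C" and "A \<noteq> {}"
    and "\<And>i. i \<in> {1..n} \<Longrightarrow> Z i \<in> measurable P (count_space L)"
  shows "expected_cost P n Z C \<le> expected_cost P n Z A"
  unfolding expected_cost_def
proof (rule integral_mono)
  have "finite A" "C \<noteq> {}" using assms finite_subset by auto
  show "integrable P (\<lambda>\<omega>. \<Sum>i=1..n. set_dist (Z i \<omega>) C)"
    by (rule integrable_sum_set_dist[OF assms(1,2,3) \<open>C \<noteq> {}\<close> assms(6)])
  show "integrable P (\<lambda>\<omega>. \<Sum>i=1..n. set_dist (Z i \<omega>) A)"
    by (rule integrable_sum_set_dist[OF assms(1,2) \<open>finite A\<close> assms(5,6)])
qed (auto intro!: sum_mono set_dist_antimono assms)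

lemma expected_cost_nonneg:
  assumes "finite C" "C \<noteq> {}"
  shows "0 \<le> expected_cost P n Z C"
  unfolding expected_cost_def
  by (intro Bochner_Integration.integral_nonneg sum_nonneg set_dist_nonneg assms)

section \<open>Averaging over the swaps\<close>

lemma ex_improving_swap:
  fixes Z :: "nat \<Rightarrow> 'w \<Rightarrow> 'a::metric_space"
  assumes P: "prob_space P" and bdd: "bounded (UNIV :: 'a set)"
    and C: "finite C" "C \<noteq> {}" and D: "finite D" "card D = card C"
    and Z: "\<And>i. i \<in> {1..n} \<Longrightarrow> Z i \<in> measurable P (count_space L)"
    and less: "5 * expected_cost P n Z D < expected_cost P n Z C"
  obtains a b where "a \<in> C" "b \<in> D - C"
    "expected_cost P n Z ((C \<union> {b}) - {a}) - expected_cost P n Z C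
       \<le> (5 * expected_cost P n Z D - expected_cost P n Z C) / card C"
proof -
  let ?E = "expected_cost P n Z"
  have ne: "D \<noteq> {}" using C D by auto
  have "\<exists>c. c \<in> C \<and> set_dist f C = dist f c" for f
    using set_dist_attained[OF C] by metis
  then obtain \<eta> where \<eta>: "\<And>f. \<eta> f \<in> C \<and> set_dist f C = dist f (\<eta> f)" by metis
  obtain \<rho> where \<rho>: "\<rho> ` D \<subseteq> C" "\<And>f g. f \<in> D \<Longrightarrow> g \<in> D \<Longrightarrow> g \<noteq> f \<Longrightarrow> \<eta> g \<noteq> \<rho> f"
    "\<And>r. card {f\<in>D. \<rho> f = r} \<le> 2"
    using ex_swap_pairing[OF C(1) D(1) D(2)[symmetric], of \<eta>] \<eta> by blast
  \<comment> \<open>Inserting after removing keeps \<open>T f\<close> nonempty even if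
    \<open>C = {f}\<close> and \<open>\<rho> f = f\<close>.\<close>
  define T where "T f = insert f (C - {\<rho> f})" for f
  let ?S = "\<lambda>A \<omega>. \<Sum>i=1..n. set_dist (Z i \<omega>) A"
  have int: "integrable P (?S A)" if "finite A" "A \<noteq> {}" for A
    by (rule integrable_sum_set_dist[OF P bdd that Z])
  have intT: "integrable P (?S (T f))" for f by (rule int) (use C in \<open>auto simp: T_def\<close>)
  have pw: "(\<Sum>f\<in>D. ?S (T f) \<omega> - ?S C \<omega>) \<le> 5 * ?S D \<omega> - ?S C \<omega>" for \<omega>
  proof -
    have "(\<Sum>f\<in>D. ?S (T f) \<omega> - ?S C \<omega>)
        = (\<Sum>i=1..n. \<Sum>f\<in>D. set_dist (Z i \<omega>) (T f) - set_dist (Z i \<omega>) C)"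
      by (subst sum.swap) (simp add: sum_subtractf)
    also have "\<dots> \<le> (\<Sum>i=1..n. 5 * set_dist (Z i \<omega>) D - set_dist (Z i \<omega>) C)"
      unfolding T_def
      by (intro sum_mono sum_swaps_set_dist_le[OF C D(1) ne, where \<eta> = \<eta>]) (use \<eta> \<rho> in auto)
    finally show ?thesis by (simp add: sum_subtractf sum_distrib_left)
  qed
  have "(\<Sum>f\<in>D. ?E (T f) - ?E C) = (\<integral>\<omega>. (\<Sum>f\<in>D. ?S (T f) \<omega> - ?S C \<omega>) \<partial>P)"
    unfolding expected_cost_def using intT int[OF C]
    by (subst Bochner_Integration.integral_sum) auto
  also have "\<dots> \<le> (\<integral>\<omega>. 5 * ?S D \<omega> - ?S C \<omega> \<partial>P)"
    using intT int[OF C] int[OF D(1) ne] by (intro integral_mono pw) auto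
  also have "\<dots> = 5 * ?E D - ?E C"
    unfolding expected_cost_def using int[OF C] int[OF D(1) ne] by simp
  finally have total: "(\<Sum>f\<in>D. ?E (T f) - ?E C) \<le> 5 * ?E D - ?E C" .
  \<comment> \<open>Some swap is at least as good as the average of all
    \<open>card D = card C\<close> swaps.\<close>
  have "\<exists>f\<in>D. ?E (T f) - ?E C \<le> (5 * ?E D - ?E C) / card C"
  proof (rule ccontr)
    assume "\<not> ?thesis"
    hence "(\<Sum>f\<in>D. (5 * ?E D - ?E C) / card C) < (\<Sum>f\<in>D. ?E (T f) - ?E C)"
      using D(1) ne by (intro sum_strict_mono) auto
    moreover have "(\<Sum>f\<in>D. (5 * ?E D - ?E C) / card C) = 5 * ?E D - ?E C"
      using C D by simp
    ultimately show False using total by linarith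
  qed
  then obtain f where f: "f \<in> D" "?E (T f) - ?E C \<le> (5 * ?E D - ?E C) / card C" by blast
  have "(5 * ?E D - ?E C) / card C < 0"
    using less C by (intro divide_neg_pos) (auto simp: card_gt_0_iff)
  hence "?E (T f) < ?E C" using f(2) by linarith
  \<comment> \<open>Otherwise \<open>T f\<close> would be a subset of \<open>C\<close>, and losing
    centres cannot lower the cost.\<close>
  have notin: "f \<notin> C"
  proof
    assume "f \<in> C"
    hence "?E C \<le> ?E (T f)"
      by (intro expected_cost_antimono[OF P bdd C(1) _ _ Z]) (auto simp: T_def)
    with \<open>?E (T f) < ?E C\<close> show False by simp
  qed
  have "\<rho> f \<in> C" using \<rho>(1) f by auto
  moreover from this have "T f = (C \<union> {f}) - {\<rho> f}" using notin by (auto simp: T_def)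
  ultimately show ?thesis using that[of "\<rho> f" f] f notin by simp
qed

theorem lemma4p10:
  fixes F :: "'a::metric_space set"
    and k n :: nat
    and P :: "'w measure"
    and Z :: "nat \<Rightarrow> 'w \<Rightarrow> 'a"
    and L :: "'a set"
  assumes "bounded (UNIV :: 'a set)" and "diameter (UNIV :: 'a set) = 1"
    and "finite F" and "1 \<le> k" and "k \<le> card F"
    and "n \<ge> 2" and "k \<le> n"
    and "prob_space P" and "countable L"
    and "\<And>i. i \<in> {1..n} \<Longrightarrow> Z i \<in> measurable P (count_space L)"
  shows "improving_moves (feasible F k) (expected_cost P n Z) (swap_nbhd F)
           (1 - 1 / (real n)\<^sup>2) (5 / (1 - 1 / real n))"
proof -
  let ?E = "expected_cost P n Z"
  have feas: "finite C" "C \<noteq> {}" "card C = k" "C \<subseteq> F" if "C \<in> feasible F k" for C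
    using that \<open>finite F\<close> \<open>1 \<le> k\<close> finite_subset by (auto simp: feasible_def)
  have "finite (feasible F k)" using \<open>finite F\<close> by (simp add: feasible_def)
  moreover have "feasible F k \<noteq> {}"
    using obtain_subset_with_card_n[OF \<open>k \<le> card F\<close>] by (auto simp: feasible_def)
  ultimately have "opt_cost (feasible F k) ?E \<in> ?E ` feasible F k"
    unfolding opt_cost_def by (intro Min_in) auto
  then obtain D where D: "D \<in> feasible F k" "opt_cost (feasible F k) ?E = ?E D" by blast
  show ?thesis
    unfolding improving_moves_def D(2)
  proof (intro ballI impI)
    fix C assume C: "C \<in> feasible F k" and gt: "5 / (1 - 1 / real n) * ?E D < ?E C"
    have n: "1 / real n \<le> 1 / 2" using \<open>n \<ge> 2\<close> by (simp add: field_simps)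
    hence "5 * ?E D < (1 - 1 / real n) * ?E C"
      using gt by (subst (asm) times_divide_eq_left, subst (asm) pos_divide_less_eq)
        (auto simp: mult.commute)
    \<comment> \<open>The choice of \<gamma> leaves a gap of more than a fraction 1/n of the current
      cost, to be shared among k swaps.\<close>
    hence less: "5 * ?E D < ?E C - ?E C / real n" by (simp add: algebra_simps)
    have C0: "0 \<le> ?E C" using feas[OF C] by (intro expected_cost_nonneg)
    hence "5 * ?E D < ?E C" using less by (smt (verit) divide_nonneg_nonneg of_nat_0_le_iff)
    with feas[OF C] feas[OF D(1)] obtain a b where ab: "a \<in> C" "b \<in> D - C"
      "?E ((C \<union> {b}) - {a}) - ?E C \<le> (5 * ?E D - ?E C) / card C"
      using ex_improving_swap[OF assms(8,1), of C D n Z L] assms(10) by metis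
    have "(5 * ?E D - ?E C) / card C \<le> - (?E C / real n) / real k"
      unfolding feas(3)[OF C] by (rule divide_right_mono) (use less in auto)
    \<comment> \<open>Here \<open>k \<le> n\<close> turns the relative gain 1/(n k) into the bound
      1/(n n) that appears in \<beta>.\<close>
    moreover have "?E C / (real n)\<^sup>2 \<le> ?E C / real n / real k"
      unfolding power2_eq_square divide_divide_eq_left
      using C0 \<open>1 \<le> k\<close> \<open>k \<le> n\<close> by (intro divide_left_mono mult_left_mono) auto
    ultimately have "?E ((C \<union> {b}) - {a}) \<le> (1 - 1 / (real n)\<^sup>2) * ?E C"
      using ab(3) by (simp add: algebra_simps)
    moreover have "(C \<union> {b}) - {a} \<in> swap_nbhd F C"
      using ab feas(4)[OF D(1)] by (auto simp: swap_nbhd_def)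
    ultimately show "\<exists>C'\<in>swap_nbhd F C. ?E C' \<le> (1 - 1 / (real n)\<^sup>2) * ?E C" by blast
  qed
qed

end
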